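(* Let $n$ be a positive integer and let $\mu,\nu$ be symmetric probability distributions over $\{0,1\}^n$ which are $(k,\delta)$-wise indistinguishable. Then for all integers $0\le s\le k<t<n$, \[ \Delta_t(\mu,\nu)\le \sqrt{n+1}\,\exp\!\left(-\frac{(n-t)(s+1)(s+2)}{2n(t+s+2)}\right)+\delta\,\sqrt{2(s+1)}\cdot 2^s . \] Equivalently, the reconstruction advantage of $\mu,\nu$ over $t$ bits is at most this quantity.
   Context: A distribution $\mu$ on $\{0,1\}^n$ is symmetric if its probability mass function depends only on the Hamming weight of its input. For $S\subseteq[n]$, $\mu_S$ denotes the marginal distribution of $\mu$ on the coordinates in $S$. The statistical distance is $\Delta(\mu,\nu)=\frac12\sum_z|\Pr_\mu[z]-\Pr_\nu[z]|$, and $\Delta_k(\mu,\nu):=\max_{S\subseteq[n],|S|=k}\Delta(\mu_S,\nu_S)$. The pair $\mu,\nu$ is $(k,\delta)$-wise indistinguishable if $\Delta(\mu_S,\nu_S)\le\delta$ for every $S\subseteq[n]$ with $|S|\le k$. The reconstruction advantage over $t$ bits is the maximum over $S\subseteq[n]$ with $|S|=t$ and tests $T:\{0,1\}^t\to\{0,1\}$ of $|\mathbb E_{X\sim\mu}[T(X_S)]-\mathbb E_{Y\sim\nu}[T(Y_S)]|$, which equals $\Delta_t(\mu,\nu)$. *)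

theory Defs
  imports "HOL-Probability.Probability"
begin

text \<open>Bit strings in \<open>{0,1}\<^sup>n\<close> are boolean lists of length \<open>n\<close>; coordinates are numbered \<open>0, \<dots>, n - 1\<close>,
  so the subsets of \<open>[n]\<close> are the subsets of \<open>{..<n}\<close>.\<close>

definition cube :: "nat \<Rightarrow> bool list set" where
  "cube n = {x. length x = n}"

definition hamming_weight :: "bool list \<Rightarrow> nat" where
  "hamming_weight x = count_list x True"

definition distribution_on_cube :: "nat \<Rightarrow> bool list pmf \<Rightarrow> bool" where
  "distribution_on_cube n \<mu> \<longleftrightarrow> set_pmf \<mu> \<subseteq> cube n"

definition symmetric_distribution :: "nat \<Rightarrow> bool list pmf \<Rightarrow> bool" where
  "symmetric_distribution n \<mu> \<longleftrightarrow>
     distribution_on_cube n \<mu> \<and>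
     (\<forall>x\<in>cube n. \<forall>y\<in>cube n. hamming_weight x = hamming_weight y \<longrightarrow> pmf \<mu> x = pmf \<mu> y)"

text \<open>For \<open>S \<subseteq> {..<n}\<close> and \<open>x \<in> cube n\<close>, \<open>nths x S\<close> lists the bits of \<open>x\<close> at the positions in \<open>S\<close>
  in increasing order of position, so the marginal lives on \<open>cube (card S)\<close>.\<close>

definition marginal :: "nat set \<Rightarrow> bool list pmf \<Rightarrow> bool list pmf" where
  "marginal S \<mu> = map_pmf (\<lambda>x. nths x S) \<mu>"

definition stat_dist :: "'a pmf \<Rightarrow> 'a pmf \<Rightarrow> real" where
  "stat_dist \<mu> \<nu> = (1 / 2) * (\<Sum>\<^sub>\<infinity>z. \<bar>pmf \<mu> z - pmf \<nu> z\<bar>)"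

text \<open>Used only for \<open>k \<le> n\<close>, where the maximum is over a finite nonempty set.\<close>

definition stat_dist_k :: "nat \<Rightarrow> nat \<Rightarrow> bool list pmf \<Rightarrow> bool list pmf \<Rightarrow> real" where
  "stat_dist_k n k \<mu> \<nu> =
     Max ((\<lambda>S. stat_dist (marginal S \<mu>) (marginal S \<nu>)) ` {S. S \<subseteq> {..<n} \<and> card S = k})"

definition wise_indistinguishable ::
    "nat \<Rightarrow> nat \<Rightarrow> real \<Rightarrow> bool list pmf \<Rightarrow> bool list pmf \<Rightarrow> bool" where
  "wise_indistinguishable n k \<delta> \<mu> \<nu> \<longleftrightarrow>
     (\<forall>S. S \<subseteq> {..<n} \<and> card S \<le> k \<longrightarrow> stat_dist (marginal S \<mu>) (marginal S \<nu>) \<le> \<delta>)"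

text \<open>Tests are extensional functions on \<open>cube t\<close>, so that the maximum is over a finite set
  (nonempty for \<open>t \<le> n\<close>).\<close>

definition reconstruction_advantage ::
    "nat \<Rightarrow> nat \<Rightarrow> bool list pmf \<Rightarrow> bool list pmf \<Rightarrow> real" where
  "reconstruction_advantage n t \<mu> \<nu> =
     Max ((\<lambda>(S, T). \<bar>measure_pmf.expectation \<mu> (\<lambda>x. T (nths x S)) -
                      measure_pmf.expectation \<nu> (\<lambda>y. T (nths y S))\<bar>) `
          ({S. S \<subseteq> {..<n} \<and> card S = t} \<times> (cube t \<rightarrow>\<^sub>E {0, 1 :: real})))"

end

theory Submission
  imports Defs
begin

text \<open>
  By symmetry a test on \<open>m\<close> bits may be taken to be a function of their Hamming weight, and averaging
  over the deletion of one bit turns it into a test on \<open>m + 1\<close> bits with the same advantage.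
  Under the uniform inner products on \<open>{0..m}\<close> this averaging operator \<open>up m\<close> has adjoint \<open>down m\<close>, and
  \<open>(m + 3) down up = (m + 1) up down + 2\<close>. This ladder relation
  diagonalises \<open>down up\<close>: its eigenvalue in degree \<open>j\<close> is \<open>1 - j (j + 1) / ((m + 1) (m + 2))\<close>.

  Split a test on \<open>t\<close> bits with values in \<open>[-1/2, 1/2]\<close> into its components of degree \<open>\<le> s\<close> and \<open>> s\<close>.
  Lifting from \<open>t\<close> to \<open>n\<close> bits shrinks the high part by the product of the eigenvalues, which is bounded by
  the exponential of a telescoping sum; \<open>\<surd>(n + 1)\<close> is the price of passing from the \<open>L\<^sup>2\<close> norm to the
  supremum norm. The low part is the lift of a test on \<open>s\<close> bits, whose advantage is controlled by \<open>\<delta>\<close>; the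
  inverse of this lift has squared norm at most \<open>binomial (2 s + 1) s \<le> 4\<^sup>s\<close>.
\<close>

subsection \<open>The averaging operators and their eigenfunctions\<close>

text \<open>If \<open>f\<close> is a function of the weight of \<open>m\<close> bits, \<open>up m f w\<close> is its average after deleting a random
  bit from a string of length \<open>m + 1\<close> and weight \<open>w\<close>. The value \<open>f (w - 1)\<close> has coefficient \<open>0\<close> for \<open>w = 0\<close>,
  and so has \<open>f (m + 1)\<close> for \<open>w = m + 1\<close>.\<close>

definition up :: "nat \<Rightarrow> (nat \<Rightarrow> real) \<Rightarrow> nat \<Rightarrow> real" where
  "up m f w = (real w * f (w - 1) + (real m + 1 - real w) * f w) / (real m + 1)"

text \<open>Laplace's rule of succession: if \<open>m + 1\<close> exchangeable bits have uniformly
  distributed weight and \<open>m\<close> of them have weight \<open>w\<close>, the remaining bit is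
  1 with probability \<open>(w + 1) / (m + 2)\<close>.\<close>

definition down :: "nat \<Rightarrow> (nat \<Rightarrow> real) \<Rightarrow> nat \<Rightarrow> real" where
  "down m f w = ((real w + 1) * f (Suc w) + (real m + 1 - real w) * f w) / (real m + 2)"

definition ip :: "nat \<Rightarrow> (nat \<Rightarrow> real) \<Rightarrow> (nat \<Rightarrow> real) \<Rightarrow> real" where
  "ip m f g = (\<Sum>w\<le>m. f w * g w) / (real m + 1)"

definition eig :: "nat \<Rightarrow> nat \<Rightarrow> real" where
  "eig j m = 1 - real j * (real j + 1) / ((real m + 1) * (real m + 2))"

text \<open>The harmonic functions of degree \<open>j\<close> are the discrete Chebyshev polynomials of degree \<open>j\<close> on
  \<open>{0..m}\<close> up to scaling; values outside \<open>{0..m}\<close> are irrelevant.\<close>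

definition harmonic :: "nat \<Rightarrow> nat \<Rightarrow> (nat \<Rightarrow> real) \<Rightarrow> bool" where
  "harmonic j m f \<longleftrightarrow> (\<forall>w\<le>m. down m (up m f) w = eig j m * f w)"

fun lift :: "nat \<Rightarrow> nat \<Rightarrow> (nat \<Rightarrow> real) \<Rightarrow> nat \<Rightarrow> real" where
  "lift m 0 f = f"
| "lift m (Suc r) f = up (m + r) (lift m r f)"

lemma up_cong:
  assumes "\<And>w. w \<le> m \<Longrightarrow> f w = g w" "w \<le> Suc m"
  shows "up m f w = up m g w"
proof (cases "w = Suc m")
  case True
  then show ?thesis using assms(1)[of m] by (simp add: up_def)
next
  case False
  then have "w \<le> m" using assms by simp
  then show ?thesis using assms(1)[of w] assms(1)[of "w - 1"] by (simp add: up_def)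
qed

lemma down_cong:
  assumes "\<And>w. w \<le> Suc m \<Longrightarrow> f w = g w" "w \<le> m"
  shows "down m f w = down m g w"
  using assms by (simp add: down_def)

lemma up_scale: "up m (\<lambda>w. c * f w) w = c * up m f w"
  by (simp add: up_def field_simps)

lemma down_scale: "down m (\<lambda>w. c * f w) w = c * down m f w"
  by (simp add: down_def field_simps)

lemma down_diff: "down m (\<lambda>w. f w - g w) w = down m f w - down m g w"
  unfolding down_def diff_divide_distrib[symmetric] by (simp add: algebra_simps)

lemma up_sum: "up m (\<lambda>w. \<Sum>j\<in>J. F j w) w = (\<Sum>j\<in>J. up m (F j) w)"
  unfolding up_def sum_distrib_left sum.distrib[symmetric] sum_divide_distrib ..

lemma down_sum: "down m (\<lambda>w. \<Sum>j\<in>J. F j w) w = (\<Sum>j\<in>J. down m (F j) w)"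
  unfolding down_def sum_distrib_left sum.distrib[symmetric] sum_divide_distrib ..

lemma down_up:
  "down (Suc m) (up (Suc m) f) w
     = ((real m + 1) * up m (down m f) w + 2 * f w) / (real m + 3)"
\<comment> \<open>For \<open>w = 0\<close> the truncated \<open>w - 1\<close> in \<open>up\<close>
  has coefficient 0; for \<open>w = v + 1\<close> the subtraction is exact. Each case then compares
  coefficients of neighbouring values of \<open>f\<close>.\<close>
proof (cases w)
  case 0
  have "real m + 2 \<noteq> 0" "real m + 3 \<noteq> 0" "real m + 1 \<noteq> 0" by linarith+
  then show ?thesis using 0 unfolding up_def down_def
    by (simp add: divide_simps) (simp add: algebra_simps)
next
  case (Suc v)
  have "real m + 2 \<noteq> 0" "real m + 3 \<noteq> 0" "real m + 1 \<noteq> 0" by linarith+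
  then show ?thesis using Suc unfolding up_def down_def
    by (simp add: divide_simps) (simp add: algebra_simps)
qed

text \<open>Summation by parts: the shift moves from \<open>f\<close> to \<open>g\<close>, and the
  boundary terms at \<open>w = 0\<close> and \<open>w = m + 1\<close> have zero
  coefficients.\<close>

lemma ip_up_down: "ip (Suc m) (up m f) g = ip m f (down m g)"
proof -
  have "(\<Sum>w\<le>Suc m. (real w * f (w - 1) + (real m + 1 - real w) * f w) * g w)
      = (\<Sum>w\<le>Suc m. real w * f (w - 1) * g w) + (\<Sum>w\<le>Suc m. (real m + 1 - real w) * f w * g w)"
    unfolding sum.distrib[symmetric] by (intro sum.cong) (simp_all add: algebra_simps)
  also have "(\<Sum>w\<le>Suc m. real w * f (w - 1) * g w) = (\<Sum>w\<le>m. (real w + 1) * f w * g (Suc w))"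
    by (subst sum.atMost_Suc_shift) (simp add: algebra_simps)
  also have "(\<Sum>w\<le>Suc m. (real m + 1 - real w) * f w * g w)
      = (\<Sum>w\<le>m. (real m + 1 - real w) * f w * g w)"
    by simp
  also have "(\<Sum>w\<le>m. (real w + 1) * f w * g (Suc w)) + (\<Sum>w\<le>m. (real m + 1 - real w) * f w * g w)
     = (\<Sum>w\<le>m. f w * ((real w + 1) * g (Suc w) + (real m + 1 - real w) * g w))"
    by (simp add: sum.distrib[symmetric] algebra_simps)
  finally have "(\<Sum>w\<le>Suc m. (real w * f (w - 1) + (real m + 1 - real w) * f w) * g w)
     = (\<Sum>w\<le>m. f w * ((real w + 1) * g (Suc w) + (real m + 1 - real w) * g w))" .
  moreover have "ip (Suc m) (up m f) g
    = (\<Sum>w\<le>Suc m. (real w * f (w - 1) + (real m + 1 - real w) * f w) * g w)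
       / ((real m + 1) * (real m + 2))"
    unfolding ip_def up_def times_divide_eq_left sum_divide_distrib[symmetric]
    by (simp add: divide_simps del: sum.atMost_Suc)
  moreover have "ip m f (down m g)
    = (\<Sum>w\<le>m. f w * ((real w + 1) * g (Suc w) + (real m + 1 - real w) * g w))
       / ((real m + 1) * (real m + 2))"
    unfolding ip_def down_def times_divide_eq_right sum_divide_distrib[symmetric]
    by (simp add: divide_simps)
  ultimately show ?thesis by simp
qed

lemma ip_cong:
  assumes "\<And>w. w \<le> m \<Longrightarrow> f w = f' w" "\<And>w. w \<le> m \<Longrightarrow> g w = g' w"
  shows "ip m f g = ip m f' g'"
  using assms by (simp add: ip_def)

lemma ip_commute: "ip m f g = ip m g f"
  by (simp add: ip_def mult.commute)

lemma ip_scale: "ip m f (\<lambda>w. c * g w) = c * ip m f g"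
  by (simp add: ip_def sum_distrib_left mult.left_commute)

lemma ip_nonneg: "0 \<le> ip m f f"
  by (simp add: ip_def sum_nonneg)

lemma ip_sum: "ip m f (\<lambda>w. \<Sum>j\<in>J. G j w) = (\<Sum>j\<in>J. ip m f (G j))"
  unfolding ip_def sum_distrib_left sum_divide_distrib by (rule sum.swap)

text \<open>One square is at most the whole sum. The factor \<open>m + 1\<close> undoes the
  normalisation of \<open>ip\<close>; it is the source of \<open>n + 1\<close> and
  \<open>s + 1\<close> under the roots of the final bound.\<close>

lemma square_le_ip:
  assumes "w \<le> m"
  shows "(f w)\<^sup>2 \<le> (real m + 1) * ip m f f"
proof -
  have "f w * f w \<le> (\<Sum>v\<le>m. f v * f v)"
    using assms by (intro member_le_sum) auto
  then show ?thesis by (simp add: ip_def power2_eq_square)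
qed

section \<open>Eigenvalues and harmonic functions\<close>

lemma eig_mono: "i \<le> j \<Longrightarrow> eig j m \<le> eig i m"
  unfolding eig_def by (auto intro!: divide_right_mono mult_mono)

lemma eig_pos: "j \<le> m \<Longrightarrow> 0 < eig j m"
proof -
  assume "j \<le> m"
  then have "real j * (real j + 1) \<le> real m * (real m + 1)" by (intro mult_mono) auto
  also have "\<dots> < (real m + 1) * (real m + 2)" by (simp add: algebra_simps)
  finally show ?thesis by (simp add: eig_def)
qed

lemma eig_inj:
  assumes "i \<noteq> j" shows "eig i m \<noteq> eig j m"
proof
  assume "eig i m = eig j m"
  then have "real i * (real i + 1) = real j * (real j + 1)"
    by (simp add: eig_def divide_simps)
  then have "(real i - real j) * (real i + real j + 1) = 0" by (simp add: algebra_simps)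
  moreover have "real i + real j + 1 \<noteq> 0" by linarith
  ultimately show False using assms by simp
qed

text \<open>The recursion that the ladder relation imposes on eigenvalues, so that \<open>up\<close>
  and \<open>down\<close> preserve the degree \<open>j\<close>.\<close>

lemma eig_Suc: "eig j (Suc m) = ((real m + 1) * eig j m + 2) / (real m + 3)"
proof -
  have *: "real m + 2 \<noteq> 0" "real m + 3 \<noteq> 0" "real m + 1 \<noteq> 0" by linarith+
  have "real (Suc m) + 1 = real m + 2" "real (Suc m) + 2 = real m + 3" by simp_all
  then show ?thesis unfolding eig_def using *
    by (simp only:) (simp add: divide_simps, simp add: algebra_simps)
qed

lemma harmonic_up:
  assumes "harmonic j m f" shows "harmonic j (Suc m) (up m f)"
  unfolding harmonic_def
proof (intro allI impI)
  fix w assume w: "w \<le> Suc m"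
  have "up m (down m (up m f)) w = up m (\<lambda>w. eig j m * f w) w"
    using assms w by (intro up_cong) (auto simp: harmonic_def)
  then have "up m (down m (up m f)) w = eig j m * up m f w"
    by (simp only: up_scale)
  then show "down (Suc m) (up (Suc m) (up m f)) w = eig j (Suc m) * up m f w"
    by (simp only: down_up eig_Suc) (simp add: algebra_simps)
qed

text \<open>The ladder relation at level \<open>m + 1\<close>, solved for its \<open>up down\<close>
  term. Hence \<open>down\<close> inverts \<open>up\<close> up to the scalar
  \<open>eig j m\<close>.\<close>

lemma up_down_harmonic:
  assumes "harmonic j (Suc m) f" "w \<le> Suc m"
  shows "up m (down m f) w = eig j m * f w"
proof -
  have "((real m + 1) * up m (down m f) w + 2 * f w) / (real m + 3)
      = ((real m + 1) * eig j m + 2) / (real m + 3) * f w"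
    using assms by (simp add: harmonic_def down_up[symmetric] eig_Suc[symmetric])
  moreover have nz: "real m + 3 \<noteq> 0" "real m + 1 \<noteq> 0" by linarith+
  ultimately have "(real m + 1) * up m (down m f) w + 2 * f w = ((real m + 1) * eig j m + 2) * f w"
    by (simp only: times_divide_eq_left divide_cancel_right) simp
  then have "(real m + 1) * up m (down m f) w = (real m + 1) * (eig j m * f w)"
    by algebra
  then show ?thesis using nz(2) by (simp only: mult_cancel_left) simp
qed

lemma harmonic_scale: "harmonic j m f \<Longrightarrow> harmonic j m (\<lambda>w. c * f w)"
  by (simp add: harmonic_def up_scale[abs_def] down_scale)

lemma harmonic_down:
  assumes "harmonic j (Suc m) f" shows "harmonic j m (down m f)"
  unfolding harmonic_def
proof (intro allI impI)
  fix w assume w: "w \<le> m"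
  have "down m (up m (down m f)) w = down m (\<lambda>w. eig j m * f w) w"
    using assms w by (intro down_cong) (auto simp: up_down_harmonic)
  then show "down m (up m (down m f)) w = eig j m * down m f w"
    by (simp add: down_scale)
qed

lemma ip_up_harmonic:
  assumes "harmonic j m g"
  shows "ip (Suc m) (up m f) (up m g) = eig j m * ip m f g"
proof -
  have "ip m f (down m (up m g)) = ip m f (\<lambda>w. eig j m * g w)"
    using assms by (intro ip_cong) (auto simp: harmonic_def)
  then show ?thesis by (simp add: ip_up_down ip_scale)
qed

text \<open>As for any self-adjoint operator: the product of \<open>up m f\<close> and
  \<open>up m g\<close> can be computed with either eigenvalue, and the two eigenvalues
  differ.\<close>

lemma harmonic_orthogonal:
  assumes "harmonic i m f" "harmonic j m g" "i \<noteq> j"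
  shows "ip m f g = 0"
proof -
  have "eig j m * ip m f g = eig i m * ip m f g"
    using ip_up_harmonic[OF assms(1), of g] ip_up_harmonic[OF assms(2), of f]
    by (simp add: ip_commute)
  then show ?thesis using eig_inj[OF assms(3), of m] by auto
qed

lemma harmonic_pythagoras:
  assumes "finite J" "\<And>j. j \<in> J \<Longrightarrow> harmonic j m (F j)"
  shows "ip m (\<lambda>w. \<Sum>j\<in>J. F j w) (\<lambda>w. \<Sum>j\<in>J. F j w) = (\<Sum>j\<in>J. ip m (F j) (F j))"
proof -
  have "ip m (\<lambda>w. \<Sum>j\<in>J. F j w) (\<lambda>w. \<Sum>j\<in>J. F j w)
      = (\<Sum>j\<in>J. \<Sum>i\<in>J. ip m (F j) (F i))"
    by (simp add: ip_sum ip_commute[of m "\<lambda>w. \<Sum>j\<in>J. F j w"])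
  also have "\<dots> = (\<Sum>j\<in>J. \<Sum>i\<in>J. if i = j then ip m (F j) (F j) else 0)"
    by (auto intro!: sum.cong harmonic_orthogonal[OF assms(2) assms(2)])
  also have "\<dots> = (\<Sum>j\<in>J. ip m (F j) (F j))"
    using assms(1) by (simp add: sum.delta)
  finally show ?thesis .
qed

text \<open>In the induction step the components of degree at most \<open>m\<close> are obtained by
  raising those of \<open>down m f\<close>. The remainder is killed by \<open>down\<close>, which
  makes it harmonic of degree \<open>m + 1\<close>.\<close>

lemma harmonic_decomposition:
  "\<exists>F. (\<forall>j\<le>m. harmonic j m (F j)) \<and> (\<forall>w\<le>m. f w = (\<Sum>j\<le>m. F j w))"
proof (induction m arbitrary: f)
  case 0
  have "harmonic 0 0 f" by (simp add: harmonic_def down_def up_def eig_def)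
  then show ?case by (intro exI[of _ "\<lambda>_. f"]) simp
next
  case (Suc m)
  obtain Y where Y: "\<And>j. j \<le> m \<Longrightarrow> harmonic j m (Y j)"
      "\<And>w. w \<le> m \<Longrightarrow> down m f w = (\<Sum>j\<le>m. Y j w)"
    using Suc.IH by blast
  \<comment> \<open>The factor cancels the eigenvalue produced by \<open>down m (up m _)\<close>,
    which is positive for \<open>j \<le> m\<close>.\<close>
  define X where "X j = (\<lambda>w. (1 / eig j m) * Y j w)" for j
  define R where "R = (\<lambda>w. f w - (\<Sum>j\<le>m. up m (X j) w))"
  have X: "harmonic j m (X j)" if "j \<le> m" for j
    unfolding X_def using harmonic_scale[OF Y(1)[OF that]] .
  have "down m (up m (X j)) w = Y j w" if "j \<le> m" "w \<le> m" for j w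
    using X[OF that(1)] that eig_pos[OF that(1)] by (simp add: harmonic_def X_def)
  then have "down m R w = 0" if "w \<le> m" for w
    using that Y(2) by (simp add: R_def down_diff down_sum)
  then have "up m (down m R) w = 0" if "w \<le> Suc m" for w
    using up_cong[of m "down m R" "\<lambda>_. 0" w] that by (simp add: up_def)
  \<comment> \<open>Once the \<open>up down\<close> term vanishes, the ladder relation leaves
    exactly this eigenvalue.\<close>
  moreover have "eig (Suc m) (Suc m) = 2 / (real m + 3)"
    unfolding eig_def by (simp add: divide_simps)
  ultimately have R: "harmonic (Suc m) (Suc m) R"
    by (simp add: harmonic_def down_up)
  show ?case
    using R X harmonic_up
    by (intro exI[of _ "\<lambda>j. if j = Suc m then R else up m (X j)"])
      (auto simp: R_def le_Suc_eq)
qed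

lemma lift_sum: "lift m r (\<lambda>w. \<Sum>j\<in>J. F j w) = (\<lambda>w. \<Sum>j\<in>J. lift m r (F j) w)"
  by (induction r) (auto simp: up_sum)

lemma harmonic_lift: "harmonic j m f \<Longrightarrow> harmonic j (m + r) (lift m r f)"
  by (induction r) (auto simp: harmonic_up)

lemma ip_lift:
  "harmonic j m f \<Longrightarrow>
     ip (m + r) (lift m r f) (lift m r f) = (\<Prod>i<r. eig j (m + i)) * ip m f f"
  by (induction r) (simp_all add: ip_up_harmonic[OF harmonic_lift])

text \<open>Dividing \<open>down\<close> by the eigenvalue inverts \<open>up\<close> one level at a
  time; \<open>j \<le> m\<close> keeps all these eigenvalues positive.\<close>

lemma harmonic_eq_lift:
  assumes "j \<le> m" "harmonic j (m + r) f"
  shows "\<exists>g. harmonic j m g \<and> (\<forall>w\<le>m + r. lift m r g w = f w)"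
  using assms(2)
proof (induction r arbitrary: f)
  case 0
  then show ?case by auto
next
  case (Suc r)
  define h where "h = (\<lambda>w. (1 / eig j (m + r)) * down (m + r) f w)"
  have pos: "0 < eig j (m + r)" using assms(1) by (intro eig_pos) simp
  have "harmonic j (m + r) h"
    unfolding h_def using Suc.prems by (intro harmonic_scale harmonic_down) simp
  then obtain g where g: "harmonic j m g" "\<forall>w\<le>m + r. lift m r g w = h w"
    using Suc.IH by blast
  have "lift m (Suc r) g w = f w" if "w \<le> m + Suc r" for w
  proof -
    have "lift m (Suc r) g w = up (m + r) h w"
      using g(2) that by (auto intro!: up_cong)
    also have "\<dots> = f w"
      unfolding h_def up_scale using Suc.prems that pos
      by (simp add: up_down_harmonic[of j])
    finally show ?thesis .
  qed
  then show ?case using g(1) by blast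
qed

section \<open>Estimates for products of eigenvalues\<close>

text \<open>Each factor obeys \<open>1 - x \<le> exp (- x)\<close>, and
  \<open>1 / ((m + 1) (m + 2))\<close> telescopes. The bound on \<open>a\<close> keeps the factors
  nonnegative, so the inequalities can be multiplied.\<close>

lemma prod_eig_le_exp:
  assumes "a \<le> m + 1"
  shows "(\<Prod>i<r. eig a (m + i))
     \<le> exp (- (real a * (real a + 1) * (1 / (real m + 1) - 1 / (real (m + r) + 1))))"
proof (induction r)
  case 0
  then show ?case by simp
next
  case (Suc r)
  let ?c = "real a * (real a + 1)"
  have "real a * (real a + 1) \<le> (real (m + r) + 1) * (real (m + r) + 2)"
    using assms by (intro mult_mono) auto
  then have nn: "0 \<le> eig a (m + r)" by (simp add: eig_def)
  have "eig a (m + r) = 1 + - (?c * (1 / (real (m + r) + 1) - 1 / (real (m + r) + 2)))"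
    unfolding eig_def by (simp add: divide_simps)
  also have "\<dots> \<le> exp (- (?c * (1 / (real (m + r) + 1) - 1 / (real (m + r) + 2))))"
    by (rule exp_ge_add_one_self)
  finally have "(\<Prod>i<Suc r. eig a (m + i))
    \<le> exp (- (?c * (1 / (real m + 1) - 1 / (real (m + r) + 1))))
      * exp (- (?c * (1 / (real (m + r) + 1) - 1 / (real (m + r) + 2))))"
    using Suc nn by (simp add: mult_mono)
  also have "\<dots> = exp (- (?c * (1 / (real m + 1) - 1 / (real (m + Suc r) + 1))))"
    unfolding exp_add[symmetric] by (simp add: algebra_simps)
  finally show ?case .
qed

text \<open>Over the denominator \<open>(s + r + 1) (s + r + 2)\<close> the numerator of
  \<open>eig s (s + r)\<close> factors as \<open>(r + 1) (2 s + r + 2)\<close>, so the product is a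
  quotient of factorials.\<close>

lemma prod_eig_fact:
  "(\<Prod>i<r. eig s (s + i)) * (fact (s + r) * fact (s + r + 1) * fact (2 * s + 1))
     = fact r * fact (2 * s + r + 1) * (fact s * fact (s + 1))"
proof (induction r)
  case 0
  then show ?case by simp
next
  case (Suc r)
  have nz: "real s + real r + 1 \<noteq> 0" "real s + real r + 2 \<noteq> 0" by linarith+
  have e: "eig s (s + r) * ((real s + real r + 1) * (real s + real r + 2))
     = (real r + 1) * (2 * real s + real r + 2)"
    unfolding eig_def using nz by (simp add: divide_simps) (simp add: algebra_simps)
  have f: "fact (s + Suc r) = (real s + real r + 1) * fact (s + r)"
    "fact (s + Suc r + 1) = (real s + real r + 2) * fact (s + r + 1)"
    "fact (Suc r) = (real r + 1) * fact r"
    "fact (2 * s + Suc r + 1) = (2 * real s + real r + 2) * fact (2 * s + r + 1)"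
    by (simp_all add: algebra_simps)
  have "(\<Prod>i<Suc r. eig s (s + i)) * (fact (s + Suc r) * fact (s + Suc r + 1) * fact (2 * s + 1))
     = (eig s (s + r) * ((real s + real r + 1) * (real s + real r + 2)))
       * ((\<Prod>i<r. eig s (s + i)) * (fact (s + r) * fact (s + r + 1) * fact (2 * s + 1)))"
    unfolding f prod.lessThan_Suc by (simp only: mult_ac)
  also have "\<dots> = fact (Suc r) * fact (2 * s + Suc r + 1) * (fact s * fact (s + 1))"
    unfolding e Suc.IH f by (simp only: mult_ac)
  finally show ?case .
qed

text \<open>The two middle coefficients are equal and together at most the row sum
  \<open>2 * 4 ^ s\<close>.\<close>

lemma odd_central_binomial_le: "(2 * s + 1) choose s \<le> 4 ^ s"
proof -
  have "2 * ((2 * s + 1) choose s) = ((2 * s + 1) choose s) + ((2 * s + 1) choose (s + 1))"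
    using binomial_symmetric[of s "2 * s + 1"] by simp
  also have "\<dots> = (\<Sum>k\<in>{s, s + 1}. (2 * s + 1) choose k)" by simp
  also have "\<dots> \<le> (\<Sum>k\<le>2 * s + 1. (2 * s + 1) choose k)"
    by (intro sum_mono2) auto
  also have "\<dots> = 2 * 4 ^ s" unfolding choose_row_sum by (simp add: power_mult)
  finally show ?thesis by simp
qed

text \<open>With \<open>N = 2 (s + r) + 1\<close>, the product is
  \<open>(N choose (s + r)) / (N choose r)\<close> divided by \<open>(2 s + 1) choose s\<close>. The
  first quotient is at least 1 because \<open>s + r\<close> is central, so the bound is uniform in
  \<open>r\<close>.\<close>

lemma prod_eig_ge: "1 / 4 ^ s \<le> (\<Prod>i<r. eig s (s + i))"
proof -
  have "(2 * (s + r) + 1) choose r \<le> (2 * (s + r) + 1) choose (s + r)"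
    using binomial_maximum[of "2 * (s + r) + 1" r] by simp
  \<comment> \<open>Both sides equal \<open>fact (2 * (s + r) + 1)\<close>.\<close>
  moreover have "fact r * fact (2 * s + r + 1) * ((2 * (s + r) + 1) choose r)
      = fact (s + r) * fact (s + r + 1) * ((2 * (s + r) + 1) choose (s + r))"
    using binomial_fact_lemma[of r "2 * (s + r) + 1"]
      binomial_fact_lemma[of "s + r" "2 * (s + r) + 1"] by (simp del: fact_Suc add: algebra_simps)
  ultimately have "fact (s + r) * fact (s + r + 1) * ((2 * (s + r) + 1) choose r)
      \<le> fact r * fact (2 * s + r + 1) * ((2 * (s + r) + 1) choose r)"
    by (simp del: fact_Suc)
  then have "fact (s + r) * fact (s + r + 1) \<le> (fact r * fact (2 * s + r + 1) :: nat)"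
    by (rule mult_right_le_imp_le) simp
  then have "real (fact (s + r) * fact (s + r + 1)) \<le> real (fact r * fact (2 * s + r + 1))"
    by (simp only: of_nat_le_iff)
  then have a: "fact (s + r) * fact (s + r + 1) \<le> (fact r * fact (2 * s + r + 1) :: real)"
    by (simp only: of_nat_mult of_nat_fact)
  have "fact s * fact (s + 1) * ((2 * s + 1) choose s) = fact (2 * s + 1)"
    using binomial_fact_lemma[of s "2 * s + 1"] by (simp del: fact_Suc)
  then have "fact (2 * s + 1) \<le> (4 ^ s * (fact s * fact (s + 1)) :: nat)"
    using odd_central_binomial_le[of s] by (metis mult.commute mult_le_mono2)
  then have "real (fact (2 * s + 1)) \<le> real (4 ^ s * (fact s * fact (s + 1)))"
    by (simp only: of_nat_le_iff)
  then have b: "fact (2 * s + 1) \<le> (4 ^ s * (fact s * fact (s + 1)) :: real)"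
    by (simp only: of_nat_mult of_nat_fact of_nat_power of_nat_numeral)
  let ?P = "\<Prod>i<r. eig s (s + i)"
  let ?a = "fact (s + r) * fact (s + r + 1) :: real" and ?b = "fact (2 * s + 1) :: real"
  have "?a * ?b \<le> (fact r * fact (2 * s + r + 1)) * (4 ^ s * (fact s * fact (s + 1)))"
    by (rule mult_mono[OF a b]) auto
  also have "\<dots> = 4 ^ s * (fact r * fact (2 * s + r + 1) * (fact s * fact (s + 1)))"
    by (simp only: mult_ac)
  also have "\<dots> = 4 ^ s * (?P * (?a * ?b))"
    by (subst prod_eig_fact) (rule refl)
  also have "\<dots> = 4 ^ s * ?P * (?a * ?b)"
    by (rule mult.assoc[symmetric])
  finally have "1 * (?a * ?b) \<le> 4 ^ s * ?P * (?a * ?b)" by simp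
  then have "1 \<le> 4 ^ s * ?P"
    by (rule mult_right_le_imp_le) simp
  then show ?thesis by (simp add: divide_simps mult.commute)
qed

text \<open>The lifted components stay orthogonal. Eigenvalues decrease with the degree, so the
  lowest degree \<open>a\<close> supplies a common factor.\<close>

lemma high_part_bound:
  fixes F :: "nat \<Rightarrow> nat \<Rightarrow> real"
  assumes F: "\<And>j. j \<in> J \<Longrightarrow> harmonic j t (F j)" and J: "finite J" "\<And>j. j \<in> J \<Longrightarrow> a \<le> j \<and> j \<le> t"
    and w: "w \<le> t + r"
  shows "(lift t r (\<lambda>w. \<Sum>j\<in>J. F j w) w)\<^sup>2
    \<le> (real (t + r) + 1) * ((\<Prod>i<r. eig a (t + i)) * (\<Sum>j\<in>J. ip t (F j) (F j)))"
proof -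
  let ?G = "\<lambda>w. \<Sum>j\<in>J. lift t r (F j) w"
  have "ip (t + r) ?G ?G = (\<Sum>j\<in>J. ip (t + r) (lift t r (F j)) (lift t r (F j)))"
    using J(1) F by (intro harmonic_pythagoras harmonic_lift)
  also have "\<dots> = (\<Sum>j\<in>J. (\<Prod>i<r. eig j (t + i)) * ip t (F j) (F j))"
    using F by (intro sum.cong refl ip_lift)
  also have "\<dots> \<le> (\<Sum>j\<in>J. (\<Prod>i<r. eig a (t + i)) * ip t (F j) (F j))"
  proof (intro sum_mono mult_right_mono prod_mono conjI ip_nonneg)
    fix j i assume "j \<in> J"
    then have j: "a \<le> j" "j \<le> t" using J(2) by auto
    show "0 \<le> eig j (t + i)" using j(2) eig_pos[of j "t + i"] by simp
    show "eig j (t + i) \<le> eig a (t + i)" using j(1) by (rule eig_mono)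
  qed
  also have "\<dots> = (\<Prod>i<r. eig a (t + i)) * (\<Sum>j\<in>J. ip t (F j) (F j))"
    by (simp add: sum_distrib_left)
  finally have "ip (t + r) ?G ?G \<le> (\<Prod>i<r. eig a (t + i)) * (\<Sum>j\<in>J. ip t (F j) (F j))" .
  then have "(real (t + r) + 1) * ip (t + r) ?G ?G
     \<le> (real (t + r) + 1) * ((\<Prod>i<r. eig a (t + i)) * (\<Sum>j\<in>J. ip t (F j) (F j)))"
    by (intro mult_left_mono) auto
  then show ?thesis
    unfolding lift_sum using square_le_ip[OF w, of ?G] by linarith
qed

text \<open>Each component is pulled back to \<open>s\<close> bits separately. Degree
  \<open>s\<close> has the smallest eigenvalues and so gives the worst loss, \<open>4 ^ s\<close> in
  squared norm.\<close>

lemma low_part_lift: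
  fixes F :: "nat \<Rightarrow> nat \<Rightarrow> real"
  assumes F: "\<And>j. j \<le> s \<Longrightarrow> harmonic j (s + r) (F j)"
  shows "\<exists>g. (\<forall>w\<le>s + r. lift s r g w = (\<Sum>j\<le>s. F j w)) \<and>
    (\<forall>w\<le>s. (g w)\<^sup>2 \<le> (real s + 1) * (4 ^ s * (\<Sum>j\<le>s. ip (s + r) (F j) (F j))))"
proof -
  have "\<forall>j. \<exists>g. j \<le> s \<longrightarrow> harmonic j s g \<and> (\<forall>w\<le>s + r. lift s r g w = F j w)"
    using harmonic_eq_lift F by meson
  then obtain G where G: "\<And>j. j \<le> s \<Longrightarrow> harmonic j s (G j)"
      "\<And>j w. j \<le> s \<Longrightarrow> w \<le> s + r \<Longrightarrow> lift s r (G j) w = F j w"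
    by metis
  let ?g = "\<lambda>w. \<Sum>j\<le>s. G j w"
  have "ip s ?g ?g = (\<Sum>j\<le>s. ip s (G j) (G j))"
    using G(1) by (intro harmonic_pythagoras) auto
  also have "\<dots> \<le> (\<Sum>j\<le>s. 4 ^ s * ip (s + r) (F j) (F j))"
  proof (intro sum_mono)
    fix j assume "j \<in> {..s}"
    then have j: "j \<le> s" by simp
    have "1 / 4 ^ s \<le> (\<Prod>i<r. eig s (s + i))" by (rule prod_eig_ge)
    also have "\<dots> \<le> (\<Prod>i<r. eig j (s + i))"
      using j eig_pos[of s] by (intro prod_mono conjI eig_mono) (auto intro: less_imp_le)
    finally have "1 / 4 ^ s * ip s (G j) (G j) \<le> (\<Prod>i<r. eig j (s + i)) * ip s (G j) (G j)"
      by (intro mult_right_mono ip_nonneg)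
    also have "\<dots> = ip (s + r) (lift s r (G j)) (lift s r (G j))"
      using ip_lift[OF G(1)[OF j]] by simp
    also have "\<dots> = ip (s + r) (F j) (F j)"
      using G(2)[OF j] by (intro ip_cong)
    finally show "ip s (G j) (G j) \<le> 4 ^ s * ip (s + r) (F j) (F j)"
      by (simp add: field_simps)
  qed
  finally have "(real s + 1) * ip s ?g ?g
      \<le> (real s + 1) * (4 ^ s * (\<Sum>j\<le>s. ip (s + r) (F j) (F j)))"
    unfolding sum_distrib_left[symmetric] by (intro mult_left_mono) auto
  then have "(?g w)\<^sup>2 \<le> (real s + 1) * (4 ^ s * (\<Sum>j\<le>s. ip (s + r) (F j) (F j)))"
    if "w \<le> s" for w
    using square_le_ip[OF that, of ?g] by linarith
  moreover have "lift s r ?g w = (\<Sum>j\<le>s. F j w)" if "w \<le> s + r" for w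
    using G(2) that by (simp add: lift_sum)
  ultimately show ?thesis by blast
qed

text \<open>The difference of reciprocals is \<open>(n - t) / ((t + 1) (n + 1))\<close>, and
  \<open>(t + 1) (n + 1) \<le> n (t + s + 2)\<close> because \<open>t < n\<close>. The square
  accounts for the 2 in the denominator.\<close>

lemma exponent_bound:
  assumes "t < n"
  shows "exp (- ((real s + 1) * (real s + 2) * (1 / (real t + 1) - 1 / (real n + 1))))
    \<le> (exp (- ((real n - real t) * (real s + 1) * (real s + 2) /
                  (2 * real n * (real t + real s + 2)))))\<^sup>2"
proof -
  have pos: "0 < (real t + 1) * (real n + 1)" "0 < real n * (real t + real s + 2)"
    using assms by auto
  have "real t + 1 \<le> real n" using assms by simp
  moreover have "0 \<le> real n * real s" by simp
  moreover have "real n * (real t + real s + 2) - (real t + 1) * (real n + 1)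
      = (real n - (real t + 1)) + real n * real s"
    by (simp add: algebra_simps)
  ultimately have "(real t + 1) * (real n + 1) \<le> real n * (real t + real s + 2)"
    by linarith
  then have "((real n - real t) * (real s + 1) * (real s + 2)) / (real n * (real t + real s + 2))
      \<le> ((real n - real t) * (real s + 1) * (real s + 2)) / ((real t + 1) * (real n + 1))"
    using assms pos by (intro divide_left_mono) auto
  also have "\<dots> = (real s + 1) * (real s + 2) * (1 / (real t + 1) - 1 / (real n + 1))"
    by (simp add: divide_simps)
  finally have "exp (- ((real s + 1) * (real s + 2) * (1 / (real t + 1) - 1 / (real n + 1))))
      \<le> exp (- (((real n - real t) * (real s + 1) * (real s + 2)) / (real n * (real t + real s + 2))))"
    by (simp only: exp_le_cancel_iff neg_le_iff_le)
  also have "\<dots> = (exp (- ((real n - real t) * (real s + 1) * (real s + 2) /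
                  (2 * real n * (real t + real s + 2)))))\<^sup>2"
    unfolding exp_double[symmetric] by simp
  finally show ?thesis .
qed

subsection \<open>Advantage of weight tests\<close>

text \<open>\<open>e m w\<close> is the signed mass of a single string of length \<open>m\<close> and weight \<open>w\<close>.\<close>

definition pairing :: "(nat \<Rightarrow> nat \<Rightarrow> real) \<Rightarrow> nat \<Rightarrow> (nat \<Rightarrow> real) \<Rightarrow> real" where
  "pairing e m h = (\<Sum>w\<le>m. real (m choose w) * e m w * h w)"

lemma pairing_cong: "(\<And>w. w \<le> m \<Longrightarrow> f w = g w) \<Longrightarrow> pairing e m f = pairing e m g"
  by (simp add: pairing_def)

lemma pairing_add: "pairing e m (\<lambda>w. f w + g w) = pairing e m f + pairing e m g"
  by (simp add: pairing_def sum.distrib algebra_simps)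

lemma pairing_bound:
  assumes "\<And>w. w \<le> m \<Longrightarrow> \<bar>h w\<bar> \<le> B"
  shows "\<bar>pairing e m h\<bar> \<le> B * (\<Sum>w\<le>m. real (m choose w) * \<bar>e m w\<bar>)"
proof -
  have "\<bar>pairing e m h\<bar> \<le> (\<Sum>w\<le>m. \<bar>real (m choose w) * e m w * h w\<bar>)"
    unfolding pairing_def by (rule sum_abs)
  also have "\<dots> \<le> (\<Sum>w\<le>m. B * (real (m choose w) * \<bar>e m w\<bar>))"
    using assms by (intro sum_mono) (simp add: abs_mult mult_right_mono mult.commute[of B] mult.assoc mult_left_mono)
  finally show ?thesis by (simp add: sum_distrib_left)
qed

text \<open>The hypothesis splits the mass of a string over its two one-bit extensions. The
  absorption identities \<open>c1\<close> and \<open>c2\<close> then turn the binomials into exactly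
  the weights of \<open>up\<close>.\<close>

lemma pairing_up:
  assumes "\<And>w. w \<le> m \<Longrightarrow> e m w = e (Suc m) w + e (Suc m) (Suc w)"
  shows "pairing e m h = pairing e (Suc m) (up m h)"
proof -
  let ?r = "e (Suc m)"
  have c1: "real (m choose w) * (real m + 1) = real (Suc m choose w) * (real m + 1 - real w)"
    if "w \<le> m" for w
  proof -
    have "real ((Suc m - w) * (Suc m choose w)) = real (Suc m * (m choose w))"
      using binomial_absorb_comp[of "Suc m" w] by simp
    then show ?thesis
      using that unfolding of_nat_mult by (simp add: of_nat_diff algebra_simps)
  qed
  have c2: "real (m choose w) * (real m + 1) = real (Suc m choose Suc w) * (real w + 1)" for w
    using Suc_times_binomial_eq[of m w]
    by (simp add: algebra_simps flip: of_nat_mult of_nat_add of_nat_Suc)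
  have "pairing e m h = (\<Sum>w\<le>m. real (m choose w) * ?r w * h w)
      + (\<Sum>w\<le>m. real (m choose w) * ?r (Suc w) * h w)"
    unfolding pairing_def sum.distrib[symmetric] using assms
    by (intro sum.cong) (auto simp: algebra_simps)
  also have "(\<Sum>w\<le>m. real (m choose w) * ?r w * h w)
      = (\<Sum>w\<le>Suc m. real (Suc m choose w) * ?r w * ((real m + 1 - real w) * h w / (real m + 1)))"
  proof -
    have "real (m choose w) = real (Suc m choose w) * (real m + 1 - real w) / (real m + 1)"
      if "w \<le> m" for w
      using c1[OF that] by (simp add: eq_divide_eq)
    then show ?thesis by (simp add: mult_ac)
  qed
  \<comment> \<open>The index shift adds only the term \<open>w = 0\<close>, which has the factor
    \<open>real w\<close>.\<close>
  also have "(\<Sum>w\<le>m. real (m choose w) * ?r (Suc w) * h w)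
      = (\<Sum>w\<le>Suc m. real (Suc m choose w) * ?r w * (real w * h (w - 1) / (real m + 1)))"
  proof -
    have "real (m choose w) = real (Suc m choose Suc w) * (real w + 1) / (real m + 1)" for w
      using c2 by (simp add: eq_divide_eq)
    then show ?thesis by (subst sum.atMost_Suc_shift) (simp add: mult_ac add.commute del: binomial_Suc_Suc)
  qed
  also have "(\<Sum>w\<le>Suc m. real (Suc m choose w) * ?r w * ((real m + 1 - real w) * h w / (real m + 1)))
      + (\<Sum>w\<le>Suc m. real (Suc m choose w) * ?r w * (real w * h (w - 1) / (real m + 1)))
      = pairing e (Suc m) (up m h)"
    unfolding pairing_def up_def sum.distrib[symmetric] add_divide_distrib
    by (intro sum.cong refl) (simp only: distrib_left add.commute)
  finally show ?thesis .
qed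

lemma pairing_lift:
  assumes "\<And>i w. i < r \<Longrightarrow> w \<le> m + i \<Longrightarrow> e (m + i) w = e (Suc (m + i)) w + e (Suc (m + i)) (Suc w)"
  shows "pairing e m h = pairing e (m + r) (lift m r h)"
  using assms
proof (induction r)
  case 0
  then show ?case by simp
next
  case (Suc r)
  then have "pairing e m h = pairing e (m + r) (lift m r h)" by simp
  also have "\<dots> = pairing e (Suc (m + r)) (up (m + r) (lift m r h))"
    using Suc.prems by (intro pairing_up) simp
  finally show ?case by simp
qed

text \<open>The two parts of \<open>T\<close> are evaluated at different levels: the high part on
  \<open>n\<close> bits, where the total mass is at most 2, and the low part on \<open>s\<close>
  bits, where it is at most \<open>2 * \<delta>\<close>.\<close>

lemma pairing_test_bound:
  fixes \<delta> :: real
  assumes rec: "\<And>m w. m < n \<Longrightarrow> w \<le> m \<Longrightarrow> e m w = e (Suc m) w + e (Suc m) (Suc w)"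
    and low: "(\<Sum>w\<le>s. real (s choose w) * \<bar>e s w\<bar>) \<le> 2 * \<delta>"
    and top: "(\<Sum>w\<le>n. real (n choose w) * \<bar>e n w\<bar>) \<le> 2"
    and st: "s < t" and tn: "t < n"
    and T: "\<And>w. w \<le> t \<Longrightarrow> \<bar>T w\<bar> \<le> 1 / 2"
  shows "pairing e t T \<le> sqrt (real n + 1) *
          exp (- ((real n - real t) * (real s + 1) * (real s + 2) /
                  (2 * real n * (real t + real s + 2))))
        + \<delta> * sqrt (2 * (real s + 1)) * 2 ^ s"
proof -
  obtain F where F: "\<And>j. j \<le> t \<Longrightarrow> harmonic j t (F j)"
      "\<And>w. w \<le> t \<Longrightarrow> T w = (\<Sum>j\<le>t. F j w)"
    using harmonic_decomposition by blast
  let ?E = "exp (- ((real n - real t) * (real s + 1) * (real s + 2) /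
                  (2 * real n * (real t + real s + 2))))"
  let ?L = "\<lambda>w. \<Sum>j\<le>s. F j w" and ?H = "\<lambda>w. \<Sum>j\<in>{s<..t}. F j w"
  have un: "{..t} = {..s} \<union> {s<..t}" using st by auto
  have split: "(\<Sum>j\<le>t. f j) = (\<Sum>j\<le>s. f j) + (\<Sum>j\<in>{s<..t}. f j)" for f :: "nat \<Rightarrow> real"
    unfolding un by (rule sum.union_disjoint) auto
  have "ip t T T = ip t (\<lambda>w. \<Sum>j\<le>t. F j w) (\<lambda>w. \<Sum>j\<le>t. F j w)"
    by (intro ip_cong F(2))
  also have "\<dots> = (\<Sum>j\<le>t. ip t (F j) (F j))"
    using F(1) by (intro harmonic_pythagoras) auto
  finally have pyth: "ip t T T = (\<Sum>j\<le>t. ip t (F j) (F j))" .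
  \<comment> \<open>The bound \<open>1 / 4\<close> on the squared norm passes to both parts by
    Pythagoras; its root \<open>1 / 2\<close> later cancels the 2 in the mass bounds.\<close>
  have "(\<Sum>w\<le>t. T w * T w) \<le> (\<Sum>w\<le>t. 1 / 4)"
  proof (intro sum_mono)
    fix w assume "w \<in> {..t}"
    then have "\<bar>T w\<bar> * \<bar>T w\<bar> \<le> 1 / 2 * (1 / 2)" using T by (intro mult_mono) auto
    then show "T w * T w \<le> 1 / 4" by (simp add: abs_mult[symmetric])
  qed
  then have "ip t T T \<le> 1 / 4" by (simp add: ip_def divide_simps)
  then have parts: "(\<Sum>j\<le>s. ip t (F j) (F j)) \<le> 1 / 4" "(\<Sum>j\<in>{s<..t}. ip t (F j) (F j)) \<le> 1 / 4"
    using split[of "\<lambda>j. ip t (F j) (F j)"] pyth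
      sum_nonneg[of "{..s}" "\<lambda>j. ip t (F j) (F j)"] sum_nonneg[of "{s<..t}" "\<lambda>j. ip t (F j) (F j)"]
    by (simp_all add: ip_nonneg)

  have "\<bar>lift t (n - t) ?H w\<bar> \<le> sqrt (real n + 1) * ?E / 2" if "w \<le> n" for w
  proof -
    \<comment> \<open>The lowest degree in \<open>?H\<close> is \<open>s + 1\<close>, whence
      \<open>(s + 1) (s + 2)\<close> in the exponent.\<close>
    let ?P = "\<Prod>i<n - t. eig (s + 1) (t + i)"
    have P: "?P \<le> ?E\<^sup>2"
      using prod_eig_le_exp[of "s + 1" t "n - t"] exponent_bound[OF tn, of s] st tn
      by (simp add: add_ac)
    have "(lift t (n - t) ?H w)\<^sup>2
        \<le> (real (t + (n - t)) + 1) * (?P * (\<Sum>j\<in>{s<..t}. ip t (F j) (F j)))"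
      using F(1) that tn by (intro high_part_bound) auto
    also have "\<dots> = (real n + 1) * (?P * (\<Sum>j\<in>{s<..t}. ip t (F j) (F j)))"
      using tn by simp
    also have "\<dots> \<le> (real n + 1) * (?E\<^sup>2 * (1 / 4))"
      using P parts(2) by (intro mult_left_mono mult_mono) (auto intro: sum_nonneg ip_nonneg)
    also have "\<dots> = (sqrt (real n + 1) * ?E / 2)\<^sup>2"
      by (simp add: power_mult_distrib power_divide)
    finally show ?thesis
      by (subst power2_le_iff_abs_le[symmetric]) auto
  qed
  then have "\<bar>pairing e n (lift t (n - t) ?H)\<bar>
      \<le> sqrt (real n + 1) * ?E / 2 * (\<Sum>w\<le>n. real (n choose w) * \<bar>e n w\<bar>)"
    by (rule pairing_bound)
  also have "\<dots> \<le> sqrt (real n + 1) * ?E / 2 * 2"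
    using top by (intro mult_left_mono) auto
  finally have "\<bar>pairing e n (lift t (n - t) ?H)\<bar> \<le> sqrt (real n + 1) * ?E" by simp
  moreover have "pairing e t ?H = pairing e n (lift t (n - t) ?H)"
    using pairing_lift[of "n - t" t e ?H] rec tn by simp
  ultimately have high: "pairing e t ?H \<le> sqrt (real n + 1) * ?E" by linarith

  obtain g where g: "\<And>w. w \<le> t \<Longrightarrow> lift s (t - s) g w = ?L w"
      "\<And>w. w \<le> s \<Longrightarrow> (g w)\<^sup>2 \<le> (real s + 1) * (4 ^ s * (\<Sum>j\<le>s. ip t (F j) (F j)))"
    using low_part_lift[of s "t - s" F] F(1) st by auto
  have "\<bar>g w\<bar> \<le> sqrt (real s + 1) * 2 ^ s / 2" if "w \<le> s" for w
  proof -
    have "(g w)\<^sup>2 \<le> (real s + 1) * (4 ^ s * (1 / 4))"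
      using parts(1) by (intro order.trans[OF g(2)[OF that]] mult_left_mono) auto
    moreover have four: "(4 :: real) ^ s = (2 ^ s)\<^sup>2"
      by (simp add: power2_eq_square flip: power_mult_distrib)
    moreover have "(real s + 1) * (4 ^ s * (1 / 4)) = (sqrt (real s + 1) * 2 ^ s / 2)\<^sup>2"
      by (simp add: power_mult_distrib power_divide four)
    ultimately show ?thesis
      by (subst power2_le_iff_abs_le[symmetric]) auto
  qed
  then have "\<bar>pairing e s g\<bar>
      \<le> sqrt (real s + 1) * 2 ^ s / 2 * (\<Sum>w\<le>s. real (s choose w) * \<bar>e s w\<bar>)"
    by (rule pairing_bound)
  also have "\<dots> \<le> sqrt (real s + 1) * 2 ^ s / 2 * (2 * \<delta>)"
    using low by (intro mult_left_mono) auto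
  \<comment> \<open>The argument yields \<open>sqrt (s + 1)\<close>; passing to the larger root of
    the stated bound uses \<open>0 \<le> \<delta>\<close>, which follows from
    \<open>low\<close>.\<close>
  also have "\<dots> \<le> \<delta> * sqrt (2 * (real s + 1)) * 2 ^ s"
  proof -
    have "0 \<le> (\<Sum>w\<le>s. real (s choose w) * \<bar>e s w\<bar>)" by (intro sum_nonneg) auto
    then have "0 \<le> \<delta>" using low by linarith
    moreover have "sqrt (real s + 1) \<le> sqrt (2 * (real s + 1))" by simp
    ultimately have "\<delta> * 2 ^ s * sqrt (real s + 1) \<le> \<delta> * 2 ^ s * sqrt (2 * (real s + 1))"
      by (intro mult_left_mono) auto
    then show ?thesis by (simp only: mult_ac)
  qed
  finally have "\<bar>pairing e s g\<bar> \<le> \<delta> * sqrt (2 * (real s + 1)) * 2 ^ s" .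
  moreover have "pairing e s g = pairing e t (lift s (t - s) g)"
    using pairing_lift[of "t - s" s e g] rec st tn by simp
  moreover have "\<dots> = pairing e t ?L" by (intro pairing_cong g(1))
  ultimately have lowb: "pairing e t ?L \<le> \<delta> * sqrt (2 * (real s + 1)) * 2 ^ s" by linarith

  have "pairing e t T = pairing e t (\<lambda>w. ?L w + ?H w)"
    by (intro pairing_cong) (simp add: F(2) split)
  then show ?thesis using high lowb by (simp add: pairing_add)
qed

subsection \<open>Marginals of symmetric distributions\<close>

lemma finite_cube: "finite (cube n)"
  using finite_lists_length_eq[of "UNIV :: bool set" n] by (simp add: cube_def)

lemma card_cube: "card (cube n) = 2 ^ n"
  using card_lists_length_eq[of "UNIV :: bool set" n] by (simp add: cube_def)

lemma cube_0: "cube 0 = {[]}"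
  by (auto simp: cube_def)

lemma cube_Suc: "cube (Suc n) = (#) True ` cube n \<union> (#) False ` cube n"
  by (auto simp: cube_def length_Suc_conv image_iff)

lemma sum_cube_Suc:
  "(\<Sum>x\<in>cube (Suc n). f x) = (\<Sum>x\<in>cube n. f (True # x)) + (\<Sum>x\<in>cube n. f (False # x))"
  unfolding cube_Suc
  by (subst sum.union_disjoint) (auto simp: finite_cube sum.reindex)

lemma hamming_weight_simps [simp]:
  "hamming_weight [] = 0"
  "hamming_weight (b # x) = (if b then Suc (hamming_weight x) else hamming_weight x)"
  "hamming_weight (x @ y) = hamming_weight x + hamming_weight y"
  by (simp_all add: hamming_weight_def)

lemma hamming_weight_replicate [simp]:
  "hamming_weight (replicate w b) = (if b then w else 0)"
  by (induction w) auto

lemma hamming_weight_le: "x \<in> cube n \<Longrightarrow> hamming_weight x \<le> n"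
  using count_le_length[of x True] by (simp add: cube_def hamming_weight_def)

lemma hamming_weight_nths:
  "hamming_weight x = hamming_weight (nths x S) + hamming_weight (nths x (- S))"
proof (induction x arbitrary: S)
  case Nil
  then show ?case by simp
next
  case (Cons b x)
  have "{j. Suc j \<in> - S} = - {j. Suc j \<in> S}" by auto
  then show ?case using Cons.IH[of "{j. Suc j \<in> S}"] by (simp add: nths_Cons)
qed

lemma nths_split_inject:
  assumes "length x = length y" "nths x S = nths y S" "nths x (- S) = nths y (- S)"
  shows "x = y"
  using assms
proof (induction x y arbitrary: S rule: list_induct2)
  case Nil
  then show ?case by simp
next
  case (Cons b x c y)
  have "{j. Suc j \<in> - S} = - {j. Suc j \<in> S}" by auto
  then show ?case using Cons.IH[of "{j. Suc j \<in> S}"] Cons.prems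
    by (auto simp: nths_Cons split: if_splits)
qed

lemma nths_in_cube:
  assumes "S \<subseteq> {..<n}" "x \<in> cube n"
  shows "nths x S \<in> cube (card S)" "nths x (- S) \<in> cube (n - card S)"
proof -
  have "{i. i < n \<and> i \<in> S} = S" using assms(1) by auto
  then show "nths x S \<in> cube (card S)" using assms(2) by (simp add: cube_def length_nths)
  have "{i. i < n \<and> i \<in> - S} = {..<n} - S" by auto
  then show "nths x (- S) \<in> cube (n - card S)"
    using assms finite_subset[OF assms(1)] by (simp add: cube_def length_nths card_Diff_subset)
qed

text \<open>Injectivity suffices, since both sides have \<open>2 ^ n\<close> elements. Sums over
  strings can thus be reindexed by visible and hidden bits.\<close>

lemma bij_betw_nths_split:
  assumes "S \<subseteq> {..<n}"
  shows "bij_betw (\<lambda>x. (nths x S, nths x (- S))) (cube n) (cube (card S) \<times> cube (n - card S))"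
  (is "bij_betw ?f ?A ?B")
proof -
  have inj: "inj_on ?f ?A"
    by (rule inj_onI, rule nths_split_inject[of _ _ S]) (auto simp: cube_def)
  have "?f ` ?A \<subseteq> ?B" using nths_in_cube[OF assms] by auto
  moreover have "card (?f ` ?A) = card ?B"
    using card_mono[OF _ assms] inj
    by (simp add: card_image card_cartesian_product card_cube power_add[symmetric])
  ultimately have "?f ` ?A = ?B"
    by (intro card_subset_eq) (simp_all add: finite_cube)
  then show ?thesis using inj by (simp add: bij_betw_def)
qed

lemma sum_cube_hamming_weight:
  fixes f :: "nat \<Rightarrow> real"
  shows "(\<Sum>x\<in>cube n. f (hamming_weight x)) = (\<Sum>w\<le>n. real (n choose w) * f w)"
proof (induction n arbitrary: f)
  case 0
  then show ?case by (simp add: cube_0)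
next
  case (Suc n)
  have "(\<Sum>x\<in>cube (Suc n). f (hamming_weight x))
      = (\<Sum>w\<le>n. real (n choose w) * f (Suc w)) + (\<Sum>w\<le>n. real (n choose w) * f w)"
    using Suc.IH[of "\<lambda>w. f (Suc w)"] Suc.IH[of f] by (simp add: sum_cube_Suc)
  \<comment> \<open>The shifted sum may still run to \<open>w = n\<close>, since
    \<open>n choose Suc n\<close> is 0. Pascal's rule then merges the two sums.\<close>
  also have "(\<Sum>w\<le>n. real (n choose w) * f w)
      = f 0 + (\<Sum>w\<le>n. real (n choose Suc w) * f (Suc w))"
    using sum.atMost_Suc_shift[of "\<lambda>w. real (n choose w) * f w" n] by (simp add: binomial_eq_0)
  also have "(\<Sum>w\<le>n. real (n choose w) * f (Suc w))
        + (f 0 + (\<Sum>w\<le>n. real (n choose Suc w) * f (Suc w)))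
      = f 0 + (\<Sum>w\<le>n. real (Suc n choose Suc w) * f (Suc w))"
    by (simp add: sum.distrib distrib_right)
  also have "\<dots> = (\<Sum>w\<le>Suc n. real (Suc n choose w) * f w)"
    by (subst sum.atMost_Suc_shift) simp
  finally show ?case .
qed

text \<open>One representative of each weight \<open>w \<le> n\<close>; by symmetry it stands for
  all strings of that weight.\<close>

definition weight_mass :: "nat \<Rightarrow> bool list pmf \<Rightarrow> nat \<Rightarrow> real" where
  "weight_mass n \<mu> w = pmf \<mu> (replicate w True @ replicate (n - w) False)"

text \<open>The marginal mass of a single visible string of \<open>m\<close> bits and weight
  \<open>w\<close>; \<open>y\<close> ranges over the hidden bits.\<close>

definition marginal_mass :: "nat \<Rightarrow> bool list pmf \<Rightarrow> nat \<Rightarrow> nat \<Rightarrow> real" where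
  "marginal_mass n \<mu> m w = (\<Sum>y\<in>cube (n - m). weight_mass n \<mu> (w + hamming_weight y))"

lemma pmf_symmetric:
  assumes "symmetric_distribution n \<mu>" "x \<in> cube n"
  shows "pmf \<mu> x = weight_mass n \<mu> (hamming_weight x)"
proof -
  let ?r = "replicate (hamming_weight x) True @ replicate (n - hamming_weight x) False"
  have "?r \<in> cube n" using hamming_weight_le[OF assms(2)] by (simp add: cube_def)
  moreover have "hamming_weight ?r = hamming_weight x" by simp
  ultimately show ?thesis using assms unfolding symmetric_distribution_def weight_mass_def by metis
qed

text \<open>The sum over hidden bits is split by the value of the first one, which becomes
  visible.\<close>

lemma marginal_mass_rec:
  assumes "m < n"
  shows "marginal_mass n \<mu> m w = marginal_mass n \<mu> (Suc m) w + marginal_mass n \<mu> (Suc m) (Suc w)"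
proof -
  have "n - m = Suc (n - Suc m)" using assms by simp
  then show ?thesis unfolding marginal_mass_def by (simp add: sum_cube_Suc)
qed

lemma sum_marginal_mass_top:
  assumes "symmetric_distribution n \<mu>"
  shows "(\<Sum>w\<le>n. real (n choose w) * marginal_mass n \<mu> n w) = 1"
proof -
  have "(\<Sum>w\<le>n. real (n choose w) * marginal_mass n \<mu> n w)
      = (\<Sum>x\<in>cube n. weight_mass n \<mu> (hamming_weight x))"
    by (simp add: sum_cube_hamming_weight marginal_mass_def cube_0)
  also have "\<dots> = (\<Sum>x\<in>cube n. pmf \<mu> x)"
    using pmf_symmetric[OF assms] by simp
  also have "\<dots> = 1"
    using assms finite_cube
    by (intro sum_pmf_eq_1) (auto simp: symmetric_distribution_def distribution_on_cube_def)
  finally show ?thesis .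
qed

lemma marginal_mass_nonneg: "0 \<le> marginal_mass n \<mu> m w"
  by (simp add: marginal_mass_def weight_mass_def sum_nonneg)

lemma set_pmf_marginal:
  assumes "symmetric_distribution n \<mu>" "S \<subseteq> {..<n}"
  shows "set_pmf (marginal S \<mu>) \<subseteq> cube (card S)"
  using assms nths_in_cube(1)[OF assms(2)]
  by (auto simp: marginal_def symmetric_distribution_def distribution_on_cube_def)

lemma pmf_marginal:
  assumes "symmetric_distribution n \<mu>" "S \<subseteq> {..<n}" "z \<in> cube (card S)"
  shows "pmf (marginal S \<mu>) z = marginal_mass n \<mu> (card S) (hamming_weight z)"
proof -
  let ?A = "{x \<in> cube n. nths x S = z}" and ?p = "weight_mass n \<mu>"
  have "pmf (marginal S \<mu>) z = measure (measure_pmf \<mu>) ((\<lambda>x. nths x S) -` {z})"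
    by (simp add: marginal_def pmf_map)
  \<comment> \<open>Strings outside \<open>cube n\<close> carry no mass, so the preimage may be cut
    down to a finite set.\<close>
  also have "\<dots> = measure (measure_pmf \<mu>) ?A"
    using assms(1) by (intro measure_eq_AE AE_pmfI)
      (auto simp: symmetric_distribution_def distribution_on_cube_def)
  also have "\<dots> = (\<Sum>x\<in>?A. pmf \<mu> x)"
    by (intro measure_measure_pmf_finite) (simp add: finite_cube)
  also have "\<dots> = (\<Sum>x\<in>cube n. if nths x S = z then pmf \<mu> x else 0)"
    by (intro sum.inter_filter finite_cube)
  \<comment> \<open>The summand becomes a function of the pair of visible and hidden bits, as the
    reindexing requires.\<close>
  also have "\<dots> = (\<Sum>x\<in>cube n. case (nths x S, nths x (- S)) of (a, b) \<Rightarrow>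
      if a = z then ?p (hamming_weight a + hamming_weight b) else 0)"
  proof (intro sum.cong refl)
    fix x assume "x \<in> cube n"
    then have "pmf \<mu> x = ?p (hamming_weight (nths x S) + hamming_weight (nths x (- S)))"
      unfolding hamming_weight_nths[symmetric] by (rule pmf_symmetric[OF assms(1)])
    then show "(if nths x S = z then pmf \<mu> x else 0) = (case (nths x S, nths x (- S)) of (a, b) \<Rightarrow>
        if a = z then ?p (hamming_weight a + hamming_weight b) else 0)"
      by simp
  qed
  also have "\<dots> = (\<Sum>(a, b)\<in>cube (card S) \<times> cube (n - card S).
      if a = z then ?p (hamming_weight a + hamming_weight b) else 0)"
    by (rule sum.reindex_bij_betw[OF bij_betw_nths_split[OF assms(2)]])
  also have "\<dots> = (\<Sum>a\<in>cube (card S). if a = z then marginal_mass n \<mu> (card S) (hamming_weight a) else 0)"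
    unfolding sum.cartesian_product[symmetric] by (intro sum.cong) (auto simp: marginal_mass_def)
  also have "\<dots> = marginal_mass n \<mu> (card S) (hamming_weight z)"
    using assms(3) finite_cube by (simp add: sum.delta)
  finally show ?thesis .
qed

section \<open>Statistical distance and tests\<close>

lemma stat_dist_finite:
  assumes "finite A" "set_pmf P \<subseteq> A" "set_pmf Q \<subseteq> A"
  shows "stat_dist P Q = (\<Sum>z\<in>A. \<bar>pmf P z - pmf Q z\<bar>) / 2"
proof -
  have "pmf P z = 0" "pmf Q z = 0" if "z \<notin> A" for z
    using assms(2,3) that by (auto simp: pmf_eq_0_set_pmf)
  then have "(\<Sum>\<^sub>\<infinity>z. \<bar>pmf P z - pmf Q z\<bar>) = (\<Sum>\<^sub>\<infinity>z\<in>A. \<bar>pmf P z - pmf Q z\<bar>)"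
    by (intro infsum_cong_neutral) auto
  then show ?thesis using assms(1) by (simp add: stat_dist_def)
qed

text \<open>The signed masses sum to 0, so \<open>T\<close> may be centred to
  \<open>T - 1 / 2\<close>, whose absolute value is at most \<open>1 / 2\<close>.\<close>

lemma advantage_le_stat_dist:
  assumes A: "finite A" "set_pmf P \<subseteq> A" "set_pmf Q \<subseteq> A"
    and T: "\<And>z. z \<in> A \<Longrightarrow> 0 \<le> T z \<and> T z \<le> (1 :: real)"
  shows "\<bar>measure_pmf.expectation P T - measure_pmf.expectation Q T\<bar> \<le> stat_dist P Q"
proof -
  have E: "measure_pmf.expectation R T = (\<Sum>z\<in>A. T z * pmf R z)" if "set_pmf R \<subseteq> A" for R
    using A(1) that by (intro integral_measure_pmf_real) auto
  have "(\<Sum>z\<in>A. pmf P z - pmf Q z) = 0"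
    using A by (simp add: sum_subtractf sum_pmf_eq_1)
  then have "measure_pmf.expectation P T - measure_pmf.expectation Q T
      = (\<Sum>z\<in>A. T z * (pmf P z - pmf Q z)) - 1 / 2 * (\<Sum>z\<in>A. pmf P z - pmf Q z)"
    using A by (simp add: E sum_subtractf right_diff_distrib)
  also have "\<dots> = (\<Sum>z\<in>A. (T z - 1 / 2) * (pmf P z - pmf Q z))"
    unfolding sum_distrib_left sum_subtractf[symmetric]
    by (intro sum.cong refl) (simp add: left_diff_distrib)
  also have "\<bar>\<dots>\<bar> \<le> (\<Sum>z\<in>A. \<bar>(T z - 1 / 2) * (pmf P z - pmf Q z)\<bar>)"
    by (rule sum_abs)
  also have "\<dots> \<le> (\<Sum>z\<in>A. 1 / 2 * \<bar>pmf P z - pmf Q z\<bar>)"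
  proof (intro sum_mono)
    fix z assume "z \<in> A"
    then have "\<bar>T z - 1 / 2\<bar> \<le> 1 / 2" using T[of z] by linarith
    then show "\<bar>(T z - 1 / 2) * (pmf P z - pmf Q z)\<bar> \<le> 1 / 2 * \<bar>pmf P z - pmf Q z\<bar>"
      unfolding abs_mult by (rule mult_right_mono) simp
  qed
  also have "\<dots> = stat_dist P Q"
    by (simp add: stat_dist_finite[OF A] sum_divide_distrib)
  finally show ?thesis .
qed

lemma stat_dist_marginal:
  assumes "symmetric_distribution n \<mu>" "symmetric_distribution n \<nu>" "S \<subseteq> {..<n}"
  shows "stat_dist (marginal S \<mu>) (marginal S \<nu>)
    = (\<Sum>w\<le>card S. real (card S choose w)
        * \<bar>marginal_mass n \<mu> (card S) w - marginal_mass n \<nu> (card S) w\<bar>) / 2"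
  using assms
  by (simp add: stat_dist_finite[OF finite_cube set_pmf_marginal set_pmf_marginal]
      pmf_marginal flip: sum_cube_hamming_weight)

theorem theorem1:
  fixes n k s t :: nat and \<delta> :: real and \<mu> \<nu> :: "bool list pmf"
  assumes "n > 0"
    and "symmetric_distribution n \<mu>" and "symmetric_distribution n \<nu>"
    and "wise_indistinguishable n k \<delta> \<mu> \<nu>"
    and "s \<le> k" and "k < t" and "t < n"
  shows "stat_dist_k n t \<mu> \<nu>
      \<le> sqrt (real n + 1) *
          exp (- ((real n - real t) * (real s + 1) * (real s + 2) /
                  (2 * real n * (real t + real s + 2))))
        + \<delta> * sqrt (2 * (real s + 1)) * 2 ^ s
    \<and> reconstruction_advantage n t \<mu> \<nu>
      \<le> sqrt (real n + 1) *
          exp (- ((real n - real t) * (real s + 1) * (real s + 2) /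
                  (2 * real n * (real t + real s + 2))))
        + \<delta> * sqrt (2 * (real s + 1)) * 2 ^ s"
    (is "_ \<le> ?R \<and> _ \<le> _")
proof -
  note sym = assms(2,3)
  define e where "e m w = marginal_mass n \<mu> m w - marginal_mass n \<nu> m w" for m w
  have low: "(\<Sum>w\<le>s. real (s choose w) * \<bar>e s w\<bar>) \<le> 2 * \<delta>"
  proof -
    \<comment> \<open>The initial segment serves as witness; by symmetry every set of size
      \<open>s\<close> has the same marginal masses.\<close>
    have sub: "{..<s} \<subseteq> {..<n}" using assms(5-7) by auto
    then have "stat_dist (marginal {..<s} \<mu>) (marginal {..<s} \<nu>) \<le> \<delta>"
      using assms(4,5) by (simp add: wise_indistinguishable_def)
    then show ?thesis using stat_dist_marginal[OF sym sub] by (simp add: e_def)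
  qed
  have "(\<Sum>w\<le>n. real (n choose w) * \<bar>e n w\<bar>)
     \<le> (\<Sum>w\<le>n. real (n choose w) * marginal_mass n \<mu> n w + real (n choose w) * marginal_mass n \<nu> n w)"
  proof (intro sum_mono)
    fix w
    have "\<bar>e n w\<bar> \<le> marginal_mass n \<mu> n w + marginal_mass n \<nu> n w"
      using marginal_mass_nonneg[of n \<mu> n w] marginal_mass_nonneg[of n \<nu> n w] by (simp add: e_def)
    then show "real (n choose w) * \<bar>e n w\<bar>
      \<le> real (n choose w) * marginal_mass n \<mu> n w + real (n choose w) * marginal_mass n \<nu> n w"
      unfolding distrib_left[symmetric] by (rule mult_left_mono) simp
  qed
  also have "\<dots> = 2" using sym by (simp add: sum.distrib sum_marginal_mass_top)
  finally have top: "(\<Sum>w\<le>n. real (n choose w) * \<bar>e n w\<bar>) \<le> 2" .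
  have rec: "e m w = e (Suc m) w + e (Suc m) (Suc w)" if "m < n" for m w
    using marginal_mass_rec[OF that] by (simp add: e_def)
  \<comment> \<open>This weight test attains the statistical distance, because
    \<open>x * sgn x = \<bar>x\<bar>\<close>.\<close>
  have "pairing e t (\<lambda>w. sgn (e t w) / 2) \<le> ?R"
    using assms(5-7) by (intro pairing_test_bound rec low top) (auto simp: sgn_if)
  also have "pairing e t (\<lambda>w. sgn (e t w) / 2) = (\<Sum>w\<le>t. real (t choose w) * \<bar>e t w\<bar>) / 2"
    unfolding pairing_def sum_divide_distrib by (intro sum.cong refl) (simp add: abs_sgn mult.assoc)
  finally have sd: "stat_dist (marginal S \<mu>) (marginal S \<nu>) \<le> ?R" if "S \<subseteq> {..<n}" "card S = t" for S
    using stat_dist_marginal[OF sym that(1)] that(2) by (simp add: e_def)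
  have adv: "\<bar>measure_pmf.expectation \<mu> (\<lambda>x. T (nths x S)) -
      measure_pmf.expectation \<nu> (\<lambda>y. T (nths y S))\<bar> \<le> ?R"
    if S: "S \<subseteq> {..<n}" "card S = t" and T: "T \<in> cube t \<rightarrow>\<^sub>E {0, 1}" for S T
  proof -
    have "\<bar>measure_pmf.expectation (marginal S \<mu>) T - measure_pmf.expectation (marginal S \<nu>) T\<bar>
        \<le> stat_dist (marginal S \<mu>) (marginal S \<nu>)"
    proof (rule advantage_le_stat_dist[OF finite_cube set_pmf_marginal[OF sym(1) S(1)]
          set_pmf_marginal[OF sym(2) S(1)]])
      fix z assume "z \<in> cube (card S)"
      then have "T z \<in> {0, 1}" using T S(2) by auto
      then show "0 \<le> T z \<and> T z \<le> 1" by auto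
    qed
    then show ?thesis using sd[OF S] by (simp add: marginal_def)
  qed
  let ?Ss = "{S. S \<subseteq> {..<n} \<and> card S = t}" and ?Ts = "cube t \<rightarrow>\<^sub>E {0, 1 :: real}"
  have fin: "finite ?Ss" by (rule finite_subset[of _ "Pow {..<n}"]) auto
  have ne: "{..<t} \<in> ?Ss" using assms(7) by auto
  have "stat_dist_k n t \<mu> \<nu> \<le> ?R"
    unfolding stat_dist_k_def
  proof (intro Max.boundedI finite_imageI fin)
    show "(\<lambda>S. stat_dist (marginal S \<mu>) (marginal S \<nu>)) ` ?Ss \<noteq> {}"
      using ne by blast
    fix a assume "a \<in> (\<lambda>S. stat_dist (marginal S \<mu>) (marginal S \<nu>)) ` ?Ss"
    then show "a \<le> ?R" using sd by blast
  qed
  moreover have "reconstruction_advantage n t \<mu> \<nu> \<le> ?R"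
    unfolding reconstruction_advantage_def
  proof (intro Max.boundedI finite_imageI finite_cartesian_product fin finite_PiE finite_cube)
    \<comment> \<open>The zero test, restricted to \<open>cube t\<close> to be extensional, shows
      that the maximum is over a nonempty set.\<close>
    have "(\<lambda>z\<in>cube t. 0) \<in> ?Ts" by auto
    then show "(\<lambda>(S, T). \<bar>measure_pmf.expectation \<mu> (\<lambda>x. T (nths x S)) -
        measure_pmf.expectation \<nu> (\<lambda>y. T (nths y S))\<bar>) ` (?Ss \<times> ?Ts) \<noteq> {}"
      using ne by blast
    fix a assume "a \<in> (\<lambda>(S, T). \<bar>measure_pmf.expectation \<mu> (\<lambda>x. T (nths x S)) -
        measure_pmf.expectation \<nu> (\<lambda>y. T (nths y S))\<bar>) ` (?Ss \<times> ?Ts)"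
    then show "a \<le> ?R"
    proof (elim imageE SigmaE)
      fix p S T
      assume "a = (case p of (S, T) \<Rightarrow> \<bar>measure_pmf.expectation \<mu> (\<lambda>x. T (nths x S)) -
          measure_pmf.expectation \<nu> (\<lambda>y. T (nths y S))\<bar>)"
        and "p = (S, T)" "S \<in> ?Ss" "T \<in> ?Ts"
      then show ?thesis using adv[of S T] by simp
    qed
  qed simp
  ultimately show ?thesis by blast
qed

end
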